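(* Fix the global environment and an LL(1) syntax $s$. Then the computation of $\mathtt{parse}(\mathtt{focus}(s), ts)$ takes time linear in the number of tokens of $ts$ (ignoring the cost of evaluating the functions $f$ occurring in the syntax); that is, there is a constant $C$, depending only on $s$ and the environment, such that for every finite token sequence $ts$ of length $n$ the computation takes at most $C\,(n+1)$ steps.
   Context: **Cost model.** The properties of syntaxes (the function $\mathtt{nullable}$, membership in FIRST sets) are computed once before any token is processed and stored in the syntax nodes, so each such query costs one step; the properties of nodes $\varepsilon_v$ are also available in one step. Each call to one of the functions $\mathtt{parse}$, $\mathtt{derive}$, $\mathtt{locate}$, $\mathtt{pierce}$, $\mathtt{plug}$, $\mathtt{result}$ costs a constant number of steps plus the cost of the calls it makes. Pushing and popping a layer on the context stack costs one step. Evaluation of functions $f$ appearing in the syntax is not charged. **Values, types, tokens.** Fix a set $\mathcal V$ of values, a set $\mathcal T$ of types and a relation $v : T$ ("$v$ has type $T$"). Values and types are closed under pairing, and $(v_1,v_2):(T_1,T_2)$ iff $v_1:T_1$ and $v_2:T_2$. $T_1\to T_2$ is the set of total functions from values of type $T_1$ to values of type $T_2$. A distinguished type $\mathtt{Token}\in\mathcal T$ is fixed; values of type $\mathtt{Token}$ are tokens. There is a finite set $\mathcal K$ of kinds; each token $t$ has exactly one kind $\mathtt{getKind}(t)\in\mathcal K$, and every kind is the kind of at least one token. $\langle\rangle$ is the empty sequence, $x :: xs$ prepending. **Syntaxes.** For each type $T$ let $\Sigma_T$ be a finite set of identifiers. The sets $\mathcal S_T$ of syntaxes are defined inductively: $\mathit{elem}_k\in\mathcal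 S_{\mathtt{Token}}$ for $k\in\mathcal K$; $\bot\in\mathcal S_T$; $\varepsilon_v\in\mathcal S_T$ if $v:T$; $s_1\vee s_2\in\mathcal S_T$ if $s_1,s_2\in\mathcal S_T$; $s_1\cdot s_2\in\mathcal S_{(T_1,T_2)}$ if $s_1\in\mathcal S_{T_1}$, $s_2\in\mathcal S_{T_2}$; $f\circledcirc s\in\mathcal S_{T_2}$ if $s\in\mathcal S_{T_1}$, $f\in T_1\to T_2$; $\mathit{var}_x\in\mathcal S_T$ if $x\in\Sigma_T$. A fixed global environment, which is a finite mapping, assigns to each identifier $x\in\Sigma_T$ a syntax $\mathtt{getDef}(x)\in\mathcal S_T$. **Properties** (each the least predicate/set closed under the listed rules). PRODUCTIVE: $\varepsilon_v$, $\mathit{elem}_k$ always; $s_1\vee s_2$ if $s_1$ or $s_2$ is; $s_1\cdot s_2$ if both are; $f\circledcirc s$ if $s$ is; $\mathit{var}_x$ if $\mathtt{getDef}(x)$ is. NULLABLE$(s,v)$: NULLABLE$(\varepsilon_v,v)$; NULLABLE$(s_1\vee s_2,v)$ if NULLABLE$(s_1,v)$ or NULLABLE$(s_2,v)$; NULLABLE$(s_1\cdot s_2,(v_1,v_2))$ if NULLABLE$(s_1,v_1)$ and NULLABLE$(s_2,v_2)$; NULLABLE$(f\circledcirc s,f(v))$ if NULLABLE$(s,v)$; NULLABLE$(\mathit{var}_x,v)$ if NULLABLE$(\mathtt{getDef}(x),v)$. "$s$ nullable" means NULLABLE$(s,v)$ for some $v$. The function $\mathtt{nullable}(s)$ returns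 $\mathtt{some}(v)$ for an arbitrary (fixed) $v$ with NULLABLE$(s,v)$ if one exists, and $\mathtt{none}$ otherwise. FIRST: $k\in$ FIRST$(\mathit{elem}_k)$; $k\in$ FIRST$(s_1\vee s_2)$ if $k\in$ FIRST$(s_1)$ or $k\in$ FIRST$(s_2)$; $k\in$ FIRST$(s_1\cdot s_2)$ if ($k\in$ FIRST$(s_1)$ and $s_2$ productive) or ($s_1$ nullable and $k\in$ FIRST$(s_2)$); $k\in$ FIRST$(f\circledcirc s)$ if $k\in$ FIRST$(s)$; $k\in$ FIRST$(\mathit{var}_x)$ if $k\in$ FIRST$(\mathtt{getDef}(x))$. SNF (should-not-follow set): $k\in$ SNF$(s_1\vee s_2)$ if $k\in$ SNF$(s_1)$, or $k\in$ SNF$(s_2)$, or ($k\in$ FIRST$(s_1)$ and $s_2$ nullable), or ($s_1$ nullable and $k\in$ FIRST$(s_2)$); $k\in$ SNF$(s_1\cdot s_2)$ if ($k\in$ SNF$(s_1)$ and $s_2$ nullable) or ($s_1$ productive and $k\in$ SNF$(s_2)$); $k\in$ SNF$(f\circledcirc s)$ if $k\in$ SNF$(s)$; $k\in$ SNF$(\mathit{var}_x)$ if $k\in$ SNF$(\mathtt{getDef}(x))$. HAS-CONFLICT: $s_1\vee s_2$ if both are nullable, or FIRST$(s_1)\cap$ FIRST$(s_2)\neq\emptyset$, or $s_1$ or $s_2$ has a conflict; $s_1\cdot s_2$ if SNF$(s_1)\cap$ FIRST$(s_2)\ne\emptyset$, or $s_1$ or $s_2$ has a conflict; $f\circledcirc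 s$ if $s$ has a conflict; $\mathit{var}_x$ if $\mathtt{getDef}(x)$ has a conflict. A syntax is LL(1) iff it has no conflict. **Focused syntaxes.** Layers $\mathcal L^{T_1}_{T_2}$ (above type $T_1$, below type $T_2$): $\mathtt{apply}(f)\in\mathcal L^{T_1}_{T_2}$ for $f\in T_1\to T_2$; $\mathtt{prepend}(v)\in\mathcal L^{T_2}_{(T_1,T_2)}$ for $v:T_1$; $\mathtt{follow\text{-}by}(s)\in\mathcal L^{T_1}_{(T_1,T_2)}$ for $s\in\mathcal S_{T_2}$. A context in $\mathcal C^{T_1}_{T_2}$ is a finite stack of layers, type-aligned (each layer's below type equals the next layer's above type), the first layer having above type $T_1$ and the last having below type $T_2$; the empty stack is in $\mathcal C^T_T$. A focused syntax is a pair $(s,c)$ with $s\in\mathcal S_{T'}$, $c\in\mathcal C^{T'}_T$. **Algorithm.** $\mathtt{focus}(s)=(s,\langle\rangle)$. $\mathtt{plug}(v,c)$: $\mathtt{plug}(v,\langle\rangle)=(\varepsilon_v,\langle\rangle)$; $\mathtt{plug}(v,\mathtt{apply}(f)::c')=\mathtt{plug}(f(v),c')$; $\mathtt{plug}(v,\mathtt{prepend}(v')::c')=\mathtt{plug}((v',v),c')$; $\mathtt{plug}(v,\mathtt{follow\text{-}by}(s)::c')=(s,\mathtt{prepend}(v)::c')$. $\mathtt{locate}(k,(s,c))$: if $k\in$ FIRST$(s)$ return $\mathtt{some}((s,c))$; otherwise, if $\mathtt{nullable}(s)=\mathtt{none}$ return $\mathtt{none}$; if $\mathtt{nullable}(s)=\mathtt{some}(v)$,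 return $\mathtt{none}$ if $c=\langle\rangle$, else $\mathtt{locate}(k,\mathtt{plug}(v,c))$. $\mathtt{pierce}(k,s,c)$ (used for $s$ LL(1) with $k\in$ FIRST$(s)$): $\mathtt{pierce}(k,\mathit{elem}_k,c)=c$; $\mathtt{pierce}(k,s_1\vee s_2,c)=\mathtt{pierce}(k,s_1,c)$ if $k\in$ FIRST$(s_1)$, else $\mathtt{pierce}(k,s_2,c)$; $\mathtt{pierce}(k,s_1\cdot s_2,c)=\mathtt{pierce}(k,s_2,\mathtt{prepend}(v)::c)$ if $\mathtt{nullable}(s_1)=\mathtt{some}(v)$ and $k\notin$ FIRST$(s_1)$, else $\mathtt{pierce}(k,s_1,\mathtt{follow\text{-}by}(s_2)::c)$; $\mathtt{pierce}(k,f\circledcirc s',c)=\mathtt{pierce}(k,s',\mathtt{apply}(f)::c)$; $\mathtt{pierce}(k,\mathit{var}_x,c)=\mathtt{pierce}(k,\mathtt{getDef}(x),c)$. $\mathtt{derive}(t,(s,c))$: with $k=\mathtt{getKind}(t)$, return $\mathtt{none}$ if $\mathtt{locate}(k,(s,c))=\mathtt{none}$, and $\mathtt{some}((\varepsilon_t,\mathtt{pierce}(k,s',c')))$ if $\mathtt{locate}(k,(s,c))=\mathtt{some}((s',c'))$. $\mathtt{result}(s,c)$: $\mathtt{none}$ if $\mathtt{nullable}(s)=\mathtt{none}$; if $\mathtt{nullable}(s)=\mathtt{some}(v)$, it is $\mathtt{some}(v)$ when $c=\langle\rangle$ and $\mathtt{result}(\mathtt{plug}(v,c))$ otherwise. $\mathtt{parse}((s,c),ts)$: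 $\mathtt{parse}((s,c),\langle\rangle)=\mathtt{result}(s,c)$; $\mathtt{parse}((s,c),t::ts')$ is $\mathtt{none}$ if $\mathtt{derive}(t,(s,c))=\mathtt{none}$, and $\mathtt{parse}((s',c'),ts')$ if $\mathtt{derive}(t,(s,c))=\mathtt{some}((s',c'))$. *)

theory Defs
  imports Main
begin

section \<open>Values, types, kinds and syntaxes\<close>

text \<open>
  The sets of values and of types are the carriers of \<^typ>\<open>'v\<close> and \<^typ>\<open>'t\<close>; typing is an
  arbitrary relation. Syntaxes are raw terms over values, kinds and identifiers, and membership of
  a term in the set of syntaxes of type \<open>T\<close> is the judgement \<open>syntax_of E T\<close> below.
  The function carried by \<open>Map f s\<close> is a HOL function; only its restriction to the
  values of the source type is relevant.
\<close>

datatype ('v, 'k, 'x) stx =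
    Elem 'k
  | Bot
  | Eps 'v
  | Disj "('v, 'k, 'x) stx" "('v, 'k, 'x) stx"
  | Seq "('v, 'k, 'x) stx" "('v, 'k, 'x) stx"
  | Map "'v \<Rightarrow> 'v" "('v, 'k, 'x) stx"
  | Var 'x

text \<open>\<open>idents E T\<close> is the set of identifiers of type \<open>T\<close> ($\Sigma_T$).\<close>

record ('v, 't, 'k, 'x) env =
  has_type :: "'v \<Rightarrow> 't \<Rightarrow> bool"
  vpair :: "'v \<Rightarrow> 'v \<Rightarrow> 'v"
  tpair :: "'t \<Rightarrow> 't \<Rightarrow> 't"
  token_type :: 't
  kinds :: "'k set"
  getKind :: "'v \<Rightarrow> 'k"
  idents :: "'t \<Rightarrow> 'x set"
  getDef :: "'x \<Rightarrow> ('v, 'k, 'x) stx"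

abbreviation is_token :: "('v, 't, 'k, 'x) env \<Rightarrow> 'v \<Rightarrow> bool" where
  "is_token E t \<equiv> has_type E t (token_type E)"

inductive syntax_of :: "('v, 't, 'k, 'x) env \<Rightarrow> 't \<Rightarrow> ('v, 'k, 'x) stx \<Rightarrow> bool"
  for E where
  "k \<in> kinds E \<Longrightarrow> syntax_of E (token_type E) (Elem k)"
| "syntax_of E T Bot"
| "has_type E v T \<Longrightarrow> syntax_of E T (Eps v)"
| "\<lbrakk>syntax_of E T s1; syntax_of E T s2\<rbrakk> \<Longrightarrow> syntax_of E T (Disj s1 s2)"
| "\<lbrakk>syntax_of E T1 s1; syntax_of E T2 s2\<rbrakk> \<Longrightarrow> syntax_of E (tpair E T1 T2) (Seq s1 s2)"
| "\<lbrakk>syntax_of E T1 s; \<And>v. has_type E v T1 \<Longrightarrow> has_type E (f v) T2\<rbrakk>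
    \<Longrightarrow> syntax_of E T2 (Map f s)"
| "x \<in> idents E T \<Longrightarrow> syntax_of E T (Var x)"

text \<open>
  The global environment being a finite mapping, there are finitely many identifiers altogether.
  The same identifier may belong to several types, provided its definition has all of them.
\<close>

locale valid_env =
  fixes E :: "('v, 't, 'k, 'x) env"
  assumes vpair_inject: "vpair E v1 v2 = vpair E w1 w2 \<longleftrightarrow> v1 = w1 \<and> v2 = w2"
    and tpair_inject: "tpair E T1 T2 = tpair E U1 U2 \<longleftrightarrow> T1 = U1 \<and> T2 = U2"
    and has_type_pair:
      "has_type E (vpair E v1 v2) (tpair E T1 T2) \<longleftrightarrow> has_type E v1 T1 \<and> has_type E v2 T2"
    and finite_kinds: "finite (kinds E)"
    and getKind_in_kinds: "is_token E t \<Longrightarrow> getKind E t \<in> kinds E"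
    and kind_inhabited: "k \<in> kinds E \<Longrightarrow> \<exists>t. is_token E t \<and> getKind E t = k"
    and finite_idents: "finite (\<Union>T. idents E T)"
    and getDef_typed: "x \<in> idents E T \<Longrightarrow> syntax_of E T (getDef E x)"


section \<open>Properties of syntaxes\<close>

inductive productive :: "('v, 't, 'k, 'x) env \<Rightarrow> ('v, 'k, 'x) stx \<Rightarrow> bool"
  for E where
  "productive E (Eps v)"
| "productive E (Elem k)"
| "productive E s1 \<Longrightarrow> productive E (Disj s1 s2)"
| "productive E s2 \<Longrightarrow> productive E (Disj s1 s2)"
| "\<lbrakk>productive E s1; productive E s2\<rbrakk> \<Longrightarrow> productive E (Seq s1 s2)"
| "productive E s \<Longrightarrow> productive E (Map f s)"
| "productive E (getDef E x) \<Longrightarrow> productive E (Var x)"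

inductive nullable_with :: "('v, 't, 'k, 'x) env \<Rightarrow> ('v, 'k, 'x) stx \<Rightarrow> 'v \<Rightarrow> bool"
  for E where
  "nullable_with E (Eps v) v"
| "nullable_with E s1 v \<Longrightarrow> nullable_with E (Disj s1 s2) v"
| "nullable_with E s2 v \<Longrightarrow> nullable_with E (Disj s1 s2) v"
| "\<lbrakk>nullable_with E s1 v1; nullable_with E s2 v2\<rbrakk>
    \<Longrightarrow> nullable_with E (Seq s1 s2) (vpair E v1 v2)"
| "nullable_with E s v \<Longrightarrow> nullable_with E (Map f s) (f v)"
| "nullable_with E (getDef E x) v \<Longrightarrow> nullable_with E (Var x) v"

definition is_nullable :: "('v, 't, 'k, 'x) env \<Rightarrow> ('v, 'k, 'x) stx \<Rightarrow> bool" where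
  "is_nullable E s \<longleftrightarrow> (\<exists>v. nullable_with E s v)"

inductive in_first :: "('v, 't, 'k, 'x) env \<Rightarrow> 'k \<Rightarrow> ('v, 'k, 'x) stx \<Rightarrow> bool"
  for E k where
  "in_first E k (Elem k)"
| "in_first E k s1 \<Longrightarrow> in_first E k (Disj s1 s2)"
| "in_first E k s2 \<Longrightarrow> in_first E k (Disj s1 s2)"
| "\<lbrakk>in_first E k s1; productive E s2\<rbrakk> \<Longrightarrow> in_first E k (Seq s1 s2)"
| "\<lbrakk>is_nullable E s1; in_first E k s2\<rbrakk> \<Longrightarrow> in_first E k (Seq s1 s2)"
| "in_first E k s \<Longrightarrow> in_first E k (Map f s)"
| "in_first E k (getDef E x) \<Longrightarrow> in_first E k (Var x)"

definition FIRST :: "('v, 't, 'k, 'x) env \<Rightarrow> ('v, 'k, 'x) stx \<Rightarrow> 'k set" where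
  "FIRST E s = {k. in_first E k s}"

inductive in_snf :: "('v, 't, 'k, 'x) env \<Rightarrow> 'k \<Rightarrow> ('v, 'k, 'x) stx \<Rightarrow> bool"
  for E k where
  "in_snf E k s1 \<Longrightarrow> in_snf E k (Disj s1 s2)"
| "in_snf E k s2 \<Longrightarrow> in_snf E k (Disj s1 s2)"
| "\<lbrakk>k \<in> FIRST E s1; is_nullable E s2\<rbrakk> \<Longrightarrow> in_snf E k (Disj s1 s2)"
| "\<lbrakk>is_nullable E s1; k \<in> FIRST E s2\<rbrakk> \<Longrightarrow> in_snf E k (Disj s1 s2)"
| "\<lbrakk>in_snf E k s1; is_nullable E s2\<rbrakk> \<Longrightarrow> in_snf E k (Seq s1 s2)"
| "\<lbrakk>productive E s1; in_snf E k s2\<rbrakk> \<Longrightarrow> in_snf E k (Seq s1 s2)"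
| "in_snf E k s \<Longrightarrow> in_snf E k (Map f s)"
| "in_snf E k (getDef E x) \<Longrightarrow> in_snf E k (Var x)"

definition SNF :: "('v, 't, 'k, 'x) env \<Rightarrow> ('v, 'k, 'x) stx \<Rightarrow> 'k set" where
  "SNF E s = {k. in_snf E k s}"

inductive has_conflict :: "('v, 't, 'k, 'x) env \<Rightarrow> ('v, 'k, 'x) stx \<Rightarrow> bool"
  for E where
  "\<lbrakk>is_nullable E s1; is_nullable E s2\<rbrakk> \<Longrightarrow> has_conflict E (Disj s1 s2)"
| "FIRST E s1 \<inter> FIRST E s2 \<noteq> {} \<Longrightarrow> has_conflict E (Disj s1 s2)"
| "has_conflict E s1 \<Longrightarrow> has_conflict E (Disj s1 s2)"
| "has_conflict E s2 \<Longrightarrow> has_conflict E (Disj s1 s2)"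
| "SNF E s1 \<inter> FIRST E s2 \<noteq> {} \<Longrightarrow> has_conflict E (Seq s1 s2)"
| "has_conflict E s1 \<Longrightarrow> has_conflict E (Seq s1 s2)"
| "has_conflict E s2 \<Longrightarrow> has_conflict E (Seq s1 s2)"
| "has_conflict E s \<Longrightarrow> has_conflict E (Map f s)"
| "has_conflict E (getDef E x) \<Longrightarrow> has_conflict E (Var x)"

definition LL1 :: "('v, 't, 'k, 'x) env \<Rightarrow> ('v, 'k, 'x) stx \<Rightarrow> bool" where
  "LL1 E s \<longleftrightarrow> \<not> has_conflict E s"

text \<open>The possible choices of the function \<open>nullable\<close> used by the algorithm.\<close>

definition nullable_function ::
    "('v, 't, 'k, 'x) env \<Rightarrow> (('v, 'k, 'x) stx \<Rightarrow> 'v option) \<Rightarrow> bool" where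
  "nullable_function E nullable \<longleftrightarrow>
    (\<forall>s. case nullable s of None \<Rightarrow> \<not> is_nullable E s | Some v \<Rightarrow> nullable_with E s v)"


section \<open>The algorithm and its cost\<close>

datatype ('v, 'k, 'x) layer =
    Apply "'v \<Rightarrow> 'v"
  | Prepend 'v
  | FollowBy "('v, 'k, 'x) stx"

text \<open>A context is a stack of layers, with its top at the head of the list.\<close>

type_synonym ('v, 'k, 'x) ctxt = "('v, 'k, 'x) layer list"
type_synonym ('v, 'k, 'x) focused = "('v, 'k, 'x) stx \<times> ('v, 'k, 'x) ctxt"

definition focus :: "('v, 'k, 'x) stx \<Rightarrow> ('v, 'k, 'x) focused" where
  "focus s = (s, [])"

datatype routine = Parse | Derive | Locate | Pierce | Plug | Result

text \<open>
  A priori the functions of the algorithm are partial, so they are given by evaluation relations: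
  the last two arguments are the returned value and the number of steps of the (terminating)
  computation. A call of routine \<open>r\<close> is charged an arbitrary constant \<open>c r\<close>, one step for each
  query of \<open>nullable\<close> or of membership in a FIRST set, one step for each layer pushed or popped,
  and the cost of the calls it makes. Applying a function found in the syntax is free.
\<close>

inductive plug_run ::
    "('v, 't, 'k, 'x) env \<Rightarrow> (routine \<Rightarrow> nat) \<Rightarrow> 'v \<Rightarrow> ('v, 'k, 'x) ctxt
      \<Rightarrow> ('v, 'k, 'x) focused \<Rightarrow> nat \<Rightarrow> bool"
  for E c where
  "plug_run E c v [] (Eps v, []) (c Plug)"
| "plug_run E c (f v) ls r n
    \<Longrightarrow> plug_run E c v (Apply f # ls) r (c Plug + 1 + n)"
| "plug_run E c (vpair E v' v) ls r n
    \<Longrightarrow> plug_run E c v (Prepend v' # ls) r (c Plug + 1 + n)"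
| "plug_run E c v (FollowBy s # ls) (s, Prepend v # ls) (c Plug + 2)"

inductive locate_run ::
    "('v, 't, 'k, 'x) env \<Rightarrow> (('v, 'k, 'x) stx \<Rightarrow> 'v option) \<Rightarrow> (routine \<Rightarrow> nat)
      \<Rightarrow> 'k \<Rightarrow> ('v, 'k, 'x) focused \<Rightarrow> ('v, 'k, 'x) focused option \<Rightarrow> nat \<Rightarrow> bool"
  for E nullable c k where
  "k \<in> FIRST E s
    \<Longrightarrow> locate_run E nullable c k (s, ls) (Some (s, ls)) (c Locate + 1)"
| "\<lbrakk>k \<notin> FIRST E s; nullable s = None\<rbrakk>
    \<Longrightarrow> locate_run E nullable c k (s, ls) None (c Locate + 2)"
| "\<lbrakk>k \<notin> FIRST E s; nullable s = Some v\<rbrakk>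
    \<Longrightarrow> locate_run E nullable c k (s, []) None (c Locate + 2)"
| "\<lbrakk>k \<notin> FIRST E s; nullable s = Some v; ls \<noteq> []; plug_run E c v ls fs m;
     locate_run E nullable c k fs r n\<rbrakk>
    \<Longrightarrow> locate_run E nullable c k (s, ls) r (c Locate + 2 + m + n)"

inductive pierce_run ::
    "('v, 't, 'k, 'x) env \<Rightarrow> (('v, 'k, 'x) stx \<Rightarrow> 'v option) \<Rightarrow> (routine \<Rightarrow> nat)
      \<Rightarrow> 'k \<Rightarrow> ('v, 'k, 'x) stx \<Rightarrow> ('v, 'k, 'x) ctxt \<Rightarrow> ('v, 'k, 'x) ctxt \<Rightarrow> nat \<Rightarrow> bool"
  for E nullable c k where
  "pierce_run E nullable c k (Elem k) ls ls (c Pierce)"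
| "\<lbrakk>k \<in> FIRST E s1; pierce_run E nullable c k s1 ls r n\<rbrakk>
    \<Longrightarrow> pierce_run E nullable c k (Disj s1 s2) ls r (c Pierce + 1 + n)"
| "\<lbrakk>k \<notin> FIRST E s1; pierce_run E nullable c k s2 ls r n\<rbrakk>
    \<Longrightarrow> pierce_run E nullable c k (Disj s1 s2) ls r (c Pierce + 1 + n)"
| "\<lbrakk>nullable s1 = Some v; k \<notin> FIRST E s1; pierce_run E nullable c k s2 (Prepend v # ls) r n\<rbrakk>
    \<Longrightarrow> pierce_run E nullable c k (Seq s1 s2) ls r (c Pierce + 3 + n)"
| "\<lbrakk>nullable s1 = None \<or> k \<in> FIRST E s1; pierce_run E nullable c k s1 (FollowBy s2 # ls) r n\<rbrakk>
    \<Longrightarrow> pierce_run E nullable c k (Seq s1 s2) ls r (c Pierce + 3 + n)"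
| "pierce_run E nullable c k s (Apply f # ls) r n
    \<Longrightarrow> pierce_run E nullable c k (Map f s) ls r (c Pierce + 1 + n)"
| "pierce_run E nullable c k (getDef E x) ls r n
    \<Longrightarrow> pierce_run E nullable c k (Var x) ls r (c Pierce + n)"

inductive derive_run ::
    "('v, 't, 'k, 'x) env \<Rightarrow> (('v, 'k, 'x) stx \<Rightarrow> 'v option) \<Rightarrow> (routine \<Rightarrow> nat)
      \<Rightarrow> 'v \<Rightarrow> ('v, 'k, 'x) focused \<Rightarrow> ('v, 'k, 'x) focused option \<Rightarrow> nat \<Rightarrow> bool"
  for E nullable c t where
  "locate_run E nullable c (getKind E t) fs None n
    \<Longrightarrow> derive_run E nullable c t fs None (c Derive + n)"
| "\<lbrakk>locate_run E nullable c (getKind E t) fs (Some (s', ls')) n;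
     pierce_run E nullable c (getKind E t) s' ls' ls'' m\<rbrakk>
    \<Longrightarrow> derive_run E nullable c t fs (Some (Eps t, ls'')) (c Derive + n + m)"

inductive result_run ::
    "('v, 't, 'k, 'x) env \<Rightarrow> (('v, 'k, 'x) stx \<Rightarrow> 'v option) \<Rightarrow> (routine \<Rightarrow> nat)
      \<Rightarrow> ('v, 'k, 'x) focused \<Rightarrow> 'v option \<Rightarrow> nat \<Rightarrow> bool"
  for E nullable c where
  "nullable s = None \<Longrightarrow> result_run E nullable c (s, ls) None (c Result + 1)"
| "nullable s = Some v \<Longrightarrow> result_run E nullable c (s, []) (Some v) (c Result + 1)"
| "\<lbrakk>nullable s = Some v; ls \<noteq> []; plug_run E c v ls fs m; result_run E nullable c fs r n\<rbrakk>
    \<Longrightarrow> result_run E nullable c (s, ls) r (c Result + 1 + m + n)"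

inductive parse_run ::
    "('v, 't, 'k, 'x) env \<Rightarrow> (('v, 'k, 'x) stx \<Rightarrow> 'v option) \<Rightarrow> (routine \<Rightarrow> nat)
      \<Rightarrow> ('v, 'k, 'x) focused \<Rightarrow> 'v list \<Rightarrow> 'v option \<Rightarrow> nat \<Rightarrow> bool"
  for E nullable c where
  "result_run E nullable c fs r n \<Longrightarrow> parse_run E nullable c fs [] r (c Parse + n)"
| "derive_run E nullable c t fs None n
    \<Longrightarrow> parse_run E nullable c fs (t # ts) None (c Parse + n)"
| "\<lbrakk>derive_run E nullable c t fs (Some fs') n; parse_run E nullable c fs' ts r m\<rbrakk>
    \<Longrightarrow> parse_run E nullable c fs (t # ts) r (c Parse + n + m)"


text \<open>Both the returned value and the number of steps are determined by the arguments.\<close>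

lemma plug_run_deterministic:
  "plug_run E c v ls r n \<Longrightarrow> plug_run E c v ls r' n' \<Longrightarrow> r = r' \<and> n = n'"
proof (induction arbitrary: r' n' rule: plug_run.induct)
  case (1 v)
  then show ?case by cases simp_all
next
  case (2 f v ls r n)
  from 2(3) show ?case by cases (use "2.IH" in auto)
next
  case (3 v' v ls r n)
  from 3(3) show ?case by cases (use "3.IH" in auto)
next
  case (4 v s ls)
  then show ?case by cases simp_all
qed

lemma locate_run_deterministic:
  "locate_run E nullable c k fs r n \<Longrightarrow> locate_run E nullable c k fs r' n' \<Longrightarrow> r = r' \<and> n = n'"
proof (induction arbitrary: r' n' rule: locate_run.induct)
  case (1 s ls)
  from 1(2) show ?case by cases (use 1(1) in simp_all)
next
  case (2 s ls)
  from 2(3) show ?case by cases (use 2(1,2) in simp_all)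
next
  case (3 s v)
  from 3(3) show ?case by cases (use 3(1,2) in simp_all)
next
  case (4 s v ls fs m r n)
  from 4(7) show ?case
    by cases (use 4(1-4) "4.IH" in \<open>auto dest: plug_run_deterministic\<close>)
qed

lemma pierce_run_deterministic:
  "pierce_run E nullable c k s ls r n \<Longrightarrow> pierce_run E nullable c k s ls r' n'
    \<Longrightarrow> r = r' \<and> n = n'"
proof (induction arbitrary: r' n' rule: pierce_run.induct)
  case (1 ls)
  then show ?case by cases simp_all
next
  case (2 s1 ls r n s2)
  from 2(4) show ?case by cases (use 2(1) "2.IH" in auto)
next
  case (3 s1 s2 ls r n)
  from 3(4) show ?case by cases (use 3(1) "3.IH" in auto)
next
  case (4 s1 v s2 ls r n)
  from 4(5) show ?case by cases (use 4(1,2) "4.IH" in auto)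
next
  case (5 s1 s2 ls r n)
  from 5(4) show ?case by cases (use 5(1) "5.IH" in auto)
next
  case (6 s f ls r n)
  from 6(3) show ?case by cases (use "6.IH" in auto)
next
  case (7 x ls r n)
  from 7(3) show ?case by cases (use "7.IH" in auto)
qed

lemma derive_run_deterministic:
  "derive_run E nullable c t fs r n \<Longrightarrow> derive_run E nullable c t fs r' n' \<Longrightarrow> r = r' \<and> n = n'"
proof (induction rule: derive_run.cases)
  case (1 fs n)
  from 1 show ?case
    by (elim derive_run.cases) (auto dest: locate_run_deterministic)
next
  case (2 fs s' ls' n ls'' m)
  from 2 show ?case
    by (elim derive_run.cases) (auto dest: locate_run_deterministic pierce_run_deterministic)
qed

lemma result_run_deterministic:
  "result_run E nullable c fs r n \<Longrightarrow> result_run E nullable c fs r' n' \<Longrightarrow> r = r' \<and> n = n'"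
proof (induction arbitrary: r' n' rule: result_run.induct)
  case (1 s ls)
  from 1(2) show ?case by cases (use 1(1) in simp_all)
next
  case (2 s v)
  from 2(2) show ?case by cases (use 2(1) in simp_all)
next
  case (3 s v ls fs m r n)
  from 3(6) show ?case
    by cases (use 3(1-3) "3.IH" in \<open>auto dest: plug_run_deterministic\<close>)
qed

lemma parse_run_deterministic:
  "parse_run E nullable c fs ts r n \<Longrightarrow> parse_run E nullable c fs ts r' n' \<Longrightarrow> r = r' \<and> n = n'"
proof (induction arbitrary: r' n' rule: parse_run.induct)
  case (1 fs r n)
  from 1(2) show ?case
    by cases (use 1(1) in \<open>auto dest: result_run_deterministic\<close>)
next
  case (2 t fs n ts)
  from 2(2) show ?case
    by cases (use 2(1) in \<open>auto dest: derive_run_deterministic\<close>)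
next
  case (3 t fs fs' n ts r m)
  from 3(4) show ?case
    by cases (use 3(1) "3.IH" in \<open>auto dest: derive_run_deterministic\<close>)
qed

end

(* Amortized analysis. The potential of a context charges 2 for a FollowBy layer and 1 for any
   other layer. Plugging a value pops layers and finally turns a FollowBy into a Prepend, so it is
   paid by the drop of the potential, and so are the chains of plugs in locate and result. In the
   absence of conflicts pierce descends along the derivation of k \<in> FIRST s, hence it terminates.
   All syntaxes ever pierced lie in the finite set of subterms of s and of the definitions in the
   environment, so one bound holds for the steps and for the potential added by every pierce. *)

theory Submission
  imports Defs
begin

section \<open>Potential and pending syntaxes of a context\<close>

fun potential :: "('v, 'k, 'x) ctxt \<Rightarrow> nat" where
  "potential [] = 0"
| "potential (FollowBy s # ls) = 2 + potential ls"
| "potential (Apply f # ls) = 1 + potential ls"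
| "potential (Prepend v # ls) = 1 + potential ls"

text \<open>Apart from \<open>Eps\<close> nodes, these are the only syntaxes that plugging can bring
  into focus, so a bound on this set is preserved throughout a parse.\<close>

definition followers :: "('v, 'k, 'x) ctxt \<Rightarrow> ('v, 'k, 'x) stx set" where
  "followers ls = {s. FollowBy s \<in> set ls}"

lemma followers_simps [simp]:
  "followers [] = {}"
  "followers (FollowBy s # ls) = insert s (followers ls)"
  "followers (Apply f # ls) = followers ls"
  "followers (Prepend v # ls) = followers ls"
  by (auto simp: followers_def)

section \<open>FIRST, SNF and the absence of conflicts\<close>

lemma not_in_FIRST_Eps [simp]: "k \<notin> FIRST E (Eps v)"
  by (auto simp: FIRST_def elim: in_first.cases)

text \<open>The base case is void, since \<open>Elem k\<close> is not nullable. Membership arises at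
  a disjunction whose other branch is nullable; elsewhere nullability descends to the parts and
  provides the premises of the matching SNF rule.\<close>

lemma in_snf_of_in_first:
  assumes "in_first E k s" "is_nullable E s"
  shows "in_snf E k s"
  using assms
proof (induction rule: in_first.induct)
  case 1
  then show ?case by (auto simp: is_nullable_def elim: nullable_with.cases)
next
  case (2 s1 s2)
  then have "is_nullable E s1 \<or> is_nullable E s2"
    by (auto simp: is_nullable_def elim: nullable_with.cases)
  with 2 show ?case by (auto simp: FIRST_def intro: in_snf.intros)
next
  case (3 s2 s1)
  then have "is_nullable E s1 \<or> is_nullable E s2"
    by (auto simp: is_nullable_def elim: nullable_with.cases)
  with 3 show ?case by (auto simp: FIRST_def intro: in_snf.intros)
next
  case (4 s1 s2)
  then have "is_nullable E s1" "is_nullable E s2"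
    by (auto simp: is_nullable_def elim: nullable_with.cases)
  with 4 show ?case by (auto intro: in_snf.intros)
next
  case (5 s1 s2)
  then have null: "is_nullable E s1" "is_nullable E s2"
    by (auto simp: is_nullable_def elim: nullable_with.cases)
  \<comment> \<open>The SNF rule for a second component asks for a productive first one, which
    follows from nullability.\<close>
  have "productive E u" if "nullable_with E u v" for u v
    using that by induction (auto intro: productive.intros)
  with null 5 show ?case by (auto simp: is_nullable_def intro: in_snf.intros)
next
  case (6 s f)
  then have "is_nullable E s"
    by (auto simp: is_nullable_def elim: nullable_with.cases)
  with 6 show ?case by (auto intro: in_snf.intros)
next
  case (7 x)
  then have "is_nullable E (getDef E x)"
    by (auto simp: is_nullable_def elim: nullable_with.cases)
  with 7 show ?case by (auto intro: in_snf.intros)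
qed

lemma LL1_D:
  "LL1 E (Disj s1 s2) \<Longrightarrow> LL1 E s1 \<and> LL1 E s2 \<and> FIRST E s1 \<inter> FIRST E s2 = {}"
  "LL1 E (Seq s1 s2) \<Longrightarrow> LL1 E s1 \<and> LL1 E s2 \<and> SNF E s1 \<inter> FIRST E s2 = {}"
  "LL1 E (Map f s) \<Longrightarrow> LL1 E s"
  "LL1 E (Var x) \<Longrightarrow> LL1 E (getDef E x)"
  unfolding LL1_def by (blast intro: has_conflict.intros)+

lemma nullable_function_NoneD:
  "nullable_function E nullable \<Longrightarrow> nullable s = None \<Longrightarrow> \<not> is_nullable E s"
  unfolding nullable_function_def by (metis option.simps(4))

section \<open>Termination and cost of a single pierce\<close>

text \<open>\<open>B\<close> is chosen before \<open>nullable\<close> and the context, and one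
  number bounds both the steps and the growth of the potential. Termination is part of the
  claim.\<close>

definition pierce_bounded ::
    "('v, 't, 'k, 'x) env \<Rightarrow> (routine \<Rightarrow> nat) \<Rightarrow> 'k \<Rightarrow> ('v, 'k, 'x) stx \<Rightarrow> nat \<Rightarrow> bool" where
  "pierce_bounded E c k s B \<longleftrightarrow> (\<forall>nullable ls. nullable_function E nullable \<longrightarrow>
    (\<exists>r n. pierce_run E nullable c k s ls r n \<and> n \<le> B \<and> potential r \<le> potential ls + B))"

lemma pierce_boundedD:
  assumes "pierce_bounded E c k s B" "nullable_function E nullable"
  obtains r n where "pierce_run E nullable c k s ls r n" "n \<le> B" "potential r \<le> potential ls + B"
  using assms unfolding pierce_bounded_def by blast

lemma pierce_bounded_mono:
  assumes "pierce_bounded E c k s B" "B \<le> B'"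
  shows "pierce_bounded E c k s B'"
  unfolding pierce_bounded_def
proof (intro allI impI)
  fix nullable and ls :: "('a, 'c, 'd) ctxt"
  assume "nullable_function E nullable"
  with assms(1) obtain r n where "pierce_run E nullable c k s ls r n" "n \<le> B"
    "potential r \<le> potential ls + B" by (rule pierce_boundedD)
  with assms(2) show "\<exists>r n. pierce_run E nullable c k s ls r n \<and> n \<le> B' \<and>
      potential r \<le> potential ls + B'" by (meson add_left_mono order_trans)
qed

text \<open>Covers one recursive call: \<open>m\<close> is its overhead and \<open>push\<close> the
  new context, which may depend on \<open>nullable\<close> because a \<open>Prepend\<close> layer
  stores a value chosen by it. The 3 is the overhead of a sequence, the largest one, and also
  exceeds the potential 2 of a new \<open>FollowBy\<close>.\<close>

lemma pierce_bounded_step: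
  assumes "pierce_bounded E c k s' B" "m \<le> c Pierce + 3"
    and push: "\<And>nullable ls. potential (push nullable ls) \<le> potential ls + 2"
    and run: "\<And>nullable ls r n. nullable_function E nullable \<Longrightarrow>
      pierce_run E nullable c k s' (push nullable ls) r n \<Longrightarrow>
      pierce_run E nullable c k s ls r (m + n)"
  shows "pierce_bounded E c k s (c Pierce + 3 + B)"
  unfolding pierce_bounded_def
proof (intro allI impI)
  fix nullable and ls :: "('a, 'c, 'd) ctxt"
  assume nf: "nullable_function E nullable"
  from assms(1) nf obtain r n where rn: "pierce_run E nullable c k s' (push nullable ls) r n"
    "n \<le> B" "potential r \<le> potential (push nullable ls) + B" by (rule pierce_boundedD)
  from run[OF nf rn(1)] rn(2,3) push[of nullable ls] assms(2)
  show "\<exists>r n. pierce_run E nullable c k s ls r n \<and>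
      n \<le> c Pierce + 3 + B \<and> potential r \<le> potential ls + (c Pierce + 3 + B)"
    by (intro exI[of _ r] exI[of _ "m + n"]) simp
qed

text \<open>Induction on the derivation of FIRST instead of the syntax: unfolding a variable may
  enlarge the syntax but always shortens the derivation.\<close>

lemma ex_pierce_bounded:
  assumes "in_first E k s" "LL1 E s"
  shows "\<exists>B. pierce_bounded E c k s B"
  using assms
proof (induction rule: in_first.induct)
  case 1
  have "pierce_run E nullable c k (Elem k) ls ls (c Pierce)" for nullable ls
    by (rule pierce_run.intros)
  then have "pierce_bounded E c k (Elem k) (c Pierce)"
    unfolding pierce_bounded_def by (metis le_add1 order_refl)
  then show ?case by blast
next
  case (2 s1 s2)
  from "2.IH" LL1_D(1)[OF "2.prems"] obtain B where B: "pierce_bounded E c k s1 B" by blast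
  have "k \<in> FIRST E s1" using 2 by (simp add: FIRST_def)
  from pierce_run.intros(2)[OF this]
  have "pierce_bounded E c k (Disj s1 s2) (c Pierce + 3 + B)"
    by (intro pierce_bounded_step[OF B, where m = "c Pierce + 1"
          and push = "\<lambda>_ ls. ls"]) simp_all
  then show ?case ..
next
  case (3 s2 s1)
  from "3.IH" LL1_D(1)[OF "3.prems"] obtain B where B: "pierce_bounded E c k s2 B" by blast
  \<comment> \<open>Disjointness of the two FIRST sets forces \<open>pierce\<close> into the branch
    that the derivation uses.\<close>
  have "k \<notin> FIRST E s1" using 3 LL1_D(1)[of E s1 s2] by (auto simp: FIRST_def)
  from pierce_run.intros(3)[OF this]
  have "pierce_bounded E c k (Disj s1 s2) (c Pierce + 3 + B)"
    by (intro pierce_bounded_step[OF B, where m = "c Pierce + 1"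
          and push = "\<lambda>_ ls. ls"]) simp_all
  then show ?case ..
next
  case (4 s1 s2)
  from "4.IH" LL1_D(2)[OF "4.prems"] obtain B where B: "pierce_bounded E c k s1 B" by blast
  have "k \<in> FIRST E s1" using 4 by (simp add: FIRST_def)
  from pierce_run.intros(5)[OF disjI2[OF this]]
  have "pierce_bounded E c k (Seq s1 s2) (c Pierce + 3 + B)"
    by (intro pierce_bounded_step[OF B, where m = "c Pierce + 3"
          and push = "\<lambda>_ ls. FollowBy s2 # ls"]) simp_all
  then show ?case ..
next
  case (5 s1 s2)
  from "5.IH" LL1_D(2)[OF "5.prems"] obtain B where B: "pierce_bounded E c k s2 B" by blast
  \<comment> \<open>A nullable \<open>s1\<close> has its FIRST set inside its SNF set, which avoids the FIRST set of \<open>s2\<close>.\<close>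
  have k: "k \<notin> FIRST E s1"
    using 5 LL1_D(2)[of E s1 s2] in_snf_of_in_first[of E k s1] by (auto simp: FIRST_def SNF_def)
  \<comment> \<open>The pushed value is written with \<open>the\<close> so that a single
    \<open>push\<close> serves every choice of \<open>nullable\<close>.\<close>
  have "nullable s1 = Some (the (nullable s1))" if "nullable_function E nullable" for nullable
    using nullable_function_NoneD[OF that, of s1] 5(1) by (cases "nullable s1") auto
  then have "pierce_run E nullable c k (Seq s1 s2) ls r (c Pierce + 3 + n)"
    if "nullable_function E nullable"
      "pierce_run E nullable c k s2 (Prepend (the (nullable s1)) # ls) r n" for nullable ls r n
    using that k by (intro pierce_run.intros(4))
  then have "pierce_bounded E c k (Seq s1 s2) (c Pierce + 3 + B)"
    by (intro pierce_bounded_step[OF B, where m = "c Pierce + 3"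
          and push = "\<lambda>nullable ls. Prepend (the (nullable s1)) # ls"]) simp_all
  then show ?case ..
next
  case (6 s f)
  from "6.IH" LL1_D(3)[OF "6.prems"] obtain B where B: "pierce_bounded E c k s B" by blast
  from pierce_run.intros(6)
  have "pierce_bounded E c k (Map f s) (c Pierce + 3 + B)"
    by (intro pierce_bounded_step[OF B, where m = "c Pierce + 1"
          and push = "\<lambda>_ ls. Apply f # ls"]) simp_all
  then show ?case ..
next
  case (7 x)
  from "7.IH" LL1_D(4)[OF "7.prems"] obtain B where B: "pierce_bounded E c k (getDef E x) B" by blast
  from pierce_run.intros(7)
  have "pierce_bounded E c k (Var x) (c Pierce + 3 + B)"
    by (intro pierce_bounded_step[OF B, where m = "c Pierce" and push = "\<lambda>_ ls. ls"]) simp_all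
  then show ?case ..
qed

section \<open>A finite set of syntaxes closed under piercing\<close>

definition closed_stxs :: "('v, 't, 'k, 'x) env \<Rightarrow> ('v, 'k, 'x) stx set \<Rightarrow> bool" where
  "closed_stxs E R \<longleftrightarrow>
    (\<forall>s1 s2. Disj s1 s2 \<in> R \<longrightarrow> s1 \<in> R \<and> s2 \<in> R) \<and>
    (\<forall>s1 s2. Seq s1 s2 \<in> R \<longrightarrow> s1 \<in> R \<and> s2 \<in> R) \<and>
    (\<forall>f s. Map f s \<in> R \<longrightarrow> s \<in> R) \<and>
    (\<forall>x. Var x \<in> R \<longrightarrow> getDef E x \<in> R)"

lemma closed_stxsD:
  assumes "closed_stxs E R"
  shows "Disj s1 s2 \<in> R \<Longrightarrow> s1 \<in> R" "Disj s1 s2 \<in> R \<Longrightarrow> s2 \<in> R"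
    "Seq s1 s2 \<in> R \<Longrightarrow> s1 \<in> R" "Seq s1 s2 \<in> R \<Longrightarrow> s2 \<in> R"
    "Map f s \<in> R \<Longrightarrow> s \<in> R" "Var x \<in> R \<Longrightarrow> getDef E x \<in> R"
  using assms unfolding closed_stxs_def by blast+

text \<open>The only syntaxes pushed are second components of sequences met on the way, and closure
  keeps these in \<open>R\<close>.\<close>

lemma followers_pierce_run:
  assumes "pierce_run E nullable c k s ls r n" "closed_stxs E R" "s \<in> R" "followers ls \<subseteq> R"
  shows "followers r \<subseteq> R"
  using assms(1,3,4) by (induction rule: pierce_run.induct) (auto dest: closed_stxsD[OF assms(2)])

fun subterms :: "('v, 'k, 'x) stx \<Rightarrow> ('v, 'k, 'x) stx set" where
  "subterms (Disj s1 s2) = insert (Disj s1 s2) (subterms s1 \<union> subterms s2)"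
| "subterms (Seq s1 s2) = insert (Seq s1 s2) (subterms s1 \<union> subterms s2)"
| "subterms (Map f s) = insert (Map f s) (subterms s)"
| "subterms s = {s}"

lemma finite_subterms: "finite (subterms s)"
  by (induction s) auto

lemma self_in_subterms: "s \<in> subterms s"
  by (cases s) auto

lemma subterms_trans: "u \<in> subterms s \<Longrightarrow> subterms u \<subseteq> subterms s"
  by (induction s) auto

text \<open>Serves to show that every variable met is typed, hence one of the finitely many declared
  identifiers.\<close>

lemma syntax_of_subterms:
  "syntax_of E T s \<Longrightarrow> u \<in> subterms s \<Longrightarrow> \<exists>T'. syntax_of E T' u"
proof (induction rule: syntax_of.induct)
  case (4 T s1 s2)
  then show ?case using syntax_of.intros(4)[of E T s1 s2] by auto
next
  case (5 T1 s1 T2 s2)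
  then show ?case using syntax_of.intros(5)[of E T1 s1 T2 s2] by auto
next
  case (6 T1 s f T2)
  then show ?case using syntax_of.intros(6)[of E T1 s f T2] by auto
qed (use syntax_of.intros in \<open>fastforce+\<close>)

lemma finite_closed_LL1:
  assumes "valid_env E" "syntax_of E T s" "LL1 E s"
  obtains R where "finite R" "closed_stxs E R" "s \<in> R" "\<forall>u\<in>R. LL1 E u"
proof -
  interpret valid_env E by fact
  define I where "I = (\<Union>T. idents E T)"
  define U where "U = subterms s \<union> (\<Union>x\<in>I. subterms (getDef E x))"
  \<comment> \<open>Definitions not reachable from \<open>s\<close> may have conflicts. Filtering
    removes them without breaking closure, since LL(1) passes to components and to definitions of
    variables.\<close>
  define R where "R = {u \<in> U. LL1 E u}"
  have "finite I"
    unfolding I_def by (rule finite_idents)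
  then have "finite U"
    by (simp add: U_def finite_subterms)
  then have "finite R"
    by (simp add: R_def)
  moreover have "s \<in> R"
    using assms self_in_subterms by (auto simp: R_def U_def)
  moreover have "closed_stxs E R"
  proof -
    have typed: "\<exists>T'. syntax_of E T' u" if "u \<in> U" for u
    proof (cases "u \<in> subterms s")
      case True
      then show ?thesis by (rule syntax_of_subterms[OF assms(2)])
    next
      case False
      with that obtain x T' where "x \<in> idents E T'" "u \<in> subterms (getDef E x)"
        by (auto simp: U_def I_def)
      then show ?thesis using syntax_of_subterms[OF getDef_typed] by blast
    qed
    have sub: "subterms u \<subseteq> U" if "u \<in> U" for u
      using that subterms_trans[of u s] subterms_trans[of u "getDef E x" for x]
      by (auto simp: U_def)
    have "getDef E x \<in> U" if "Var x \<in> U" for x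
    proof -
      from typed[OF that] obtain T' where "syntax_of E T' (Var x)" ..
      then have "x \<in> I"
        by cases (auto simp: I_def)
      then show ?thesis using self_in_subterms by (auto simp: U_def)
    qed
    moreover have "s1 \<in> U \<and> s2 \<in> U" if "Disj s1 s2 \<in> U \<or> Seq s1 s2 \<in> U" for s1 s2
      using that sub[of "Disj s1 s2"] sub[of "Seq s1 s2"] self_in_subterms[of s1]
        self_in_subterms[of s2] by auto
    moreover have "u \<in> U" if "Map f u \<in> U" for f u
      using sub[OF that] self_in_subterms[of u] by auto
    ultimately show ?thesis
      unfolding closed_stxs_def R_def by (blast dest: LL1_D)
  qed
  ultimately show thesis using that by (auto simp: R_def)
qed

section \<open>Amortized cost of plug, locate and result\<close>

definition good_focused :: "('v, 'k, 'x) stx set \<Rightarrow> ('v, 'k, 'x) focused \<Rightarrow> bool" where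
  "good_focused R fs \<longleftrightarrow> (fst fs \<in> R \<or> (\<exists>v. fst fs = Eps v)) \<and> followers (snd fs) \<subseteq> R"

text \<open>Each layer handled frees one unit of potential, as a \<open>FollowBy\<close> of weight 2
  becomes a \<open>Prepend\<close> of weight 1, and costs at most \<open>c Plug + 2\<close>. The
  additive \<open>c Plug\<close> is the final call on the empty context. The strict drop gives
  termination of the chains of plugs.\<close>

lemma plug_run_amortized:
  assumes "followers ls \<subseteq> R"
  shows "\<exists>fs n. plug_run E c v ls fs n \<and> good_focused R fs \<and>
    n + (c Plug + 2) * potential (snd fs) \<le> (c Plug + 2) * potential ls + c Plug \<and>
    (ls \<noteq> [] \<longrightarrow> potential (snd fs) < potential ls)"
  using assms
proof (induction ls arbitrary: v)
  case Nil
  show ?case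
    by (rule exI[of _ "(Eps v, [])"]) (auto simp: good_focused_def intro: plug_run.intros)
next
  case (Cons l ls)
  show ?case
  proof (cases l)
    case (Apply f)
    with Cons.prems Cons.IH[of "f v"] obtain fs n where
      run: "plug_run E c (f v) ls fs n" and "good_focused R fs"
      "n + (c Plug + 2) * potential (snd fs) \<le> (c Plug + 2) * potential ls + c Plug"
      "ls \<noteq> [] \<longrightarrow> potential (snd fs) < potential ls" by auto
    \<comment> \<open>If \<open>ls\<close> is empty, the induction hypothesis yields no strict drop,
      but then the resulting context is empty and the popped layer itself accounts for it.\<close>
    moreover from this have "potential (snd fs) < potential (l # ls)"
      using Apply by (cases ls) (auto elim: plug_run.cases)
    ultimately show ?thesis using Apply plug_run.intros(2)[of E c f v ls fs n, OF run]
      by (intro exI[of _ fs] exI[of _ "c Plug + 1 + n"]) auto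
  next
    case (Prepend v')
    with Cons.prems Cons.IH[of "vpair E v' v"] obtain fs n where
      run: "plug_run E c (vpair E v' v) ls fs n" and "good_focused R fs"
      "n + (c Plug + 2) * potential (snd fs) \<le> (c Plug + 2) * potential ls + c Plug"
      "ls \<noteq> [] \<longrightarrow> potential (snd fs) < potential ls" by auto
    moreover from this have "potential (snd fs) < potential (l # ls)"
      using Prepend by (cases ls) (auto elim: plug_run.cases)
    ultimately show ?thesis using Prepend plug_run.intros(3)[of E c v' v ls fs n, OF run]
      by (intro exI[of _ fs] exI[of _ "c Plug + 1 + n"]) auto
  next
    case (FollowBy s)
    with Cons.prems plug_run.intros(4)[of E c v s ls] show ?thesis
      by (intro exI[of _ "(s, Prepend v # ls)"] exI[of _ "c Plug + 2"])
        (simp add: good_focused_def)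
  qed
qed

text \<open>As the potential drops by at least one unit, a larger weight \<open>W\<close> also
  absorbs the additive \<open>c Plug\<close> and the caller's own charge \<open>d\<close>.\<close>

lemma plug_run_pays:
  assumes "followers ls \<subseteq> R" "ls \<noteq> []" "2 * c Plug + 2 + d \<le> W"
  obtains fs n where "plug_run E c v ls fs n" "good_focused R fs"
    "potential (snd fs) < potential ls"
    "d + n + W * potential (snd fs) \<le> W * potential ls"
proof -
  from plug_run_amortized[OF assms(1), of E c v] assms(2) obtain fs n where
    fs: "plug_run E c v ls fs n" "good_focused R fs" "potential (snd fs) < potential ls" and
    n: "n + (c Plug + 2) * potential (snd fs) \<le> (c Plug + 2) * potential ls + c Plug"
    by blast
  \<comment> \<open>Writing the drop as \<open>Suc e\<close> avoids subtraction and shows the unit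
    that pays for both additive terms.\<close>
  obtain e where e: "potential ls = potential (snd fs) + Suc e"
    using fs(3) less_iff_Suc_add by auto
  have "n \<le> (c Plug + 2) * Suc e + c Plug"
    using n by (simp add: e add_mult_distrib2)
  also have "\<dots> + d \<le> (2 * c Plug + 2 + d) * Suc e"
    by (simp add: algebra_simps)
  also have "\<dots> \<le> W * Suc e"
    using assms(3) by (rule mult_le_mono1)
  finally have "d + n + W * potential (snd fs) \<le> W * potential ls"
    by (simp add: e add_mult_distrib2)
  with fs that show thesis by blast
qed

text \<open>Every round but the last is paid by the drop of its plug; the last one leaves
  \<open>c Locate + 2\<close>. On success the remaining potential is kept for later tokens, on
  failure it is given up because parsing ends.\<close>

lemma locate_run_amortized:
  assumes "good_focused R fs" "2 * c Plug + 2 + (c Locate + 2) \<le> W"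
  shows "\<exists>r n. locate_run E nullable c k fs r n \<and>
    (case r of
      None \<Rightarrow> n \<le> W * potential (snd fs) + c Locate + 2
    | Some (s', ls') \<Rightarrow> s' \<in> R \<and> k \<in> FIRST E s' \<and> followers ls' \<subseteq> R \<and>
        n + W * potential ls' \<le> W * potential (snd fs) + c Locate + 2)"
    (is "\<exists>r n. _ \<and> ?bound fs r n")
  using assms(1)
proof (induction "potential (snd fs)" arbitrary: fs rule: less_induct)
  case less
  obtain s ls where fs: "fs = (s, ls)" by (cases fs)
  show ?case
  proof (cases "k \<in> FIRST E s")
    case True
    with less.prems fs have "s \<in> R" "followers ls \<subseteq> R"
      by (auto simp: good_focused_def)
    with True fs locate_run.intros(1)[OF True, of nullable c ls] show ?thesis
      by (intro exI[of _ "Some (s, ls)"] exI[of _ "c Locate + 1"]) simp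
  next
    case False
    show ?thesis
    proof (cases "nullable s = None \<or> ls = []")
      case True
      with False have "locate_run E nullable c k fs None (c Locate + 2)"
        by (cases "nullable s") (auto simp: fs simp del: One_nat_def add_2_eq_Suc' intro: locate_run.intros)
      then show ?thesis
        by (intro exI[of _ None] exI[of _ "c Locate + 2"]) auto
    next
      case nonempty: False
      then obtain v where v: "nullable s = Some v" and ls: "ls \<noteq> []" by auto
      have "followers ls \<subseteq> R" using less.prems fs by (simp add: good_focused_def)
      from plug_run_pays[where c = c, OF this ls assms(2)] obtain gs m where gs:
        "plug_run E c v ls gs m" "good_focused R gs" "potential (snd gs) < potential ls"
        "c Locate + 2 + m + W * potential (snd gs) \<le> W * potential ls" .
      from less.hyps[of gs] gs fs obtain r n where
        rn: "locate_run E nullable c k gs r n" "?bound gs r n" by auto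
      have "locate_run E nullable c k fs r (c Locate + 2 + m + n)"
        unfolding fs using False v ls gs(1) rn(1) by (rule locate_run.intros(4))
      moreover have "?bound fs r (c Locate + 2 + m + n)"
        using rn(2) gs(4) fs by (auto split: option.splits)
      ultimately show ?thesis by blast
    qed
  qed
qed

lemma result_run_amortized:
  assumes "good_focused R fs" "2 * c Plug + 2 + (c Result + 1) \<le> W"
  shows "\<exists>r n. result_run E nullable c fs r n \<and> n \<le> W * potential (snd fs) + c Result + 1"
  using assms(1)
proof (induction "potential (snd fs)" arbitrary: fs rule: less_induct)
  case less
  obtain s ls where fs: "fs = (s, ls)" by (cases fs)
  show ?case
  proof (cases "nullable s = None \<or> ls = []")
    case True
    then have "result_run E nullable c fs (nullable s) (c Result + 1)"
      by (cases "nullable s") (auto simp: fs simp del: One_nat_def add_Suc_right intro: result_run.intros)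
    then show ?thesis by fastforce
  next
    case False
    then obtain v where v: "nullable s = Some v" and ls: "ls \<noteq> []" by auto
    have "followers ls \<subseteq> R" using less.prems fs by (simp add: good_focused_def)
    from plug_run_pays[where c = c, OF this ls assms(2)] obtain gs m where gs:
      "plug_run E c v ls gs m" "good_focused R gs" "potential (snd gs) < potential ls"
      "c Result + 1 + m + W * potential (snd gs) \<le> W * potential ls" .
    from less.hyps[of gs] gs fs obtain r n where
      rn: "result_run E nullable c gs r n" "n \<le> W * potential (snd gs) + c Result + 1" by auto
    have "result_run E nullable c fs r (c Result + 1 + m + n)"
      unfolding fs using v ls gs(1) rn(1) by (rule result_run.intros(3))
    with rn(2) gs(4) fs show ?thesis by fastforce
  qed
qed

section \<open>Uniform bounds and the cost of the whole parse\<close>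

lemma finite_pierce_bounded:
  assumes "finite R" "finite K" "\<forall>u\<in>R. LL1 E u"
  shows "\<exists>B. \<forall>u\<in>R. \<forall>k\<in>K. k \<in> FIRST E u \<longrightarrow> pierce_bounded E c k u B"
proof -
  have "\<forall>p. \<exists>B. p \<in> R \<times> K \<longrightarrow> snd p \<in> FIRST E (fst p) \<longrightarrow> pierce_bounded E c (snd p) (fst p) B"
    using ex_pierce_bounded assms(3) by (fastforce simp: FIRST_def)
  then obtain b where b: "\<forall>p. p \<in> R \<times> K \<longrightarrow> snd p \<in> FIRST E (fst p) \<longrightarrow>
      pierce_bounded E c (snd p) (fst p) (b p)"
    by (rule choice[THEN exE])
  \<comment> \<open>The sum over the finite product dominates each single bound, so no maximum over
    a possibly empty set is required.\<close>
  have "pierce_bounded E c k u (sum b (R \<times> K))" if "u \<in> R" "k \<in> K" "k \<in> FIRST E u" for u k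
  proof (rule pierce_bounded_mono)
    show "pierce_bounded E c k u (b (u, k))" using b that by simp
    show "b (u, k) \<le> sum b (R \<times> K)" using assms(1,2) that by (intro member_le_sum) auto
  qed
  then show ?thesis by blast
qed

lemma parse_run_amortized:
  assumes closed: "closed_stxs E R"
    and pierce: "\<And>u t. \<lbrakk>u \<in> R; is_token E t; getKind E t \<in> FIRST E u\<rbrakk>
      \<Longrightarrow> pierce_bounded E c (getKind E t) u B"
    and nullable: "nullable_function E nullable"
    and W: "2 * c Plug + 2 + (c Locate + 2) \<le> W" "2 * c Plug + 2 + (c Result + 1) \<le> W"
    and "\<forall>t\<in>set ts. is_token E t" "good_focused R fs"
  shows "\<exists>r n. parse_run E nullable c fs ts r n \<and>
    n \<le> W * potential (snd fs) + (c Parse + c Derive + c Locate + 2 + B + W * B) * length ts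
      + c Parse + c Result + 1"
  using assms(6,7)
proof (induction ts arbitrary: fs)
  case Nil
  from result_run_amortized[OF Nil(2) W(2), of E nullable] obtain r n where
    "result_run E nullable c fs r n" "n \<le> W * potential (snd fs) + c Result + 1" by blast
  then show ?case
    by (intro exI[of _ r] exI[of _ "c Parse + n"]) (auto intro: parse_run.intros)
next
  case (Cons t ts)
  \<comment> \<open>The amortized charge per token: the calls of \<open>parse\<close> and
    \<open>derive\<close>, the last round of \<open>locate\<close>, the steps \<open>B\<close> of
    \<open>pierce\<close>, and \<open>W * B\<close> to prepay the potential that
    \<open>pierce\<close> adds.\<close>
  let ?D = "c Parse + c Derive + c Locate + 2 + B + W * B"
  from locate_run_amortized[OF Cons.prems(2) W(1), of E nullable "getKind E t"] obtain q n where
    q: "locate_run E nullable c (getKind E t) fs q n" and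
    bound: "case q of
        None \<Rightarrow> n \<le> W * potential (snd fs) + c Locate + 2
      | Some (s', ls') \<Rightarrow> s' \<in> R \<and> getKind E t \<in> FIRST E s' \<and> followers ls' \<subseteq> R \<and>
          n + W * potential ls' \<le> W * potential (snd fs) + c Locate + 2"
    by blast
  show ?case
  proof (cases q)
    case None
    with q have "parse_run E nullable c fs (t # ts) None (c Parse + (c Derive + n))"
      by (auto intro: parse_run.intros derive_run.intros)
    moreover have "c Parse + (c Derive + n) \<le> W * potential (snd fs) + ?D"
      using bound None by simp
    ultimately show ?thesis
      by (intro exI[of _ None] exI[of _ "c Parse + (c Derive + n)"]) auto
  next
    case (Some p)
    then obtain s' ls' where some: "q = Some (s', ls')" by (cases p) auto
    with bound have s': "s' \<in> R" "getKind E t \<in> FIRST E s'" "followers ls' \<subseteq> R"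
      and n: "n + W * potential ls' \<le> W * potential (snd fs) + c Locate + 2" by auto
    have "pierce_bounded E c (getKind E t) s' B"
      using s' Cons.prems by (intro pierce) auto
    from this nullable obtain ls'' m where
      m: "pierce_run E nullable c (getKind E t) s' ls' ls'' m" "m \<le> B"
        "potential ls'' \<le> potential ls' + B" by (rule pierce_boundedD)
    have "good_focused R (Eps t, ls'')"
      using followers_pierce_run[OF m(1) closed s'(1,3)] by (simp add: good_focused_def)
    with Cons obtain r l where
      l: "parse_run E nullable c (Eps t, ls'') ts r l"
        "l \<le> W * potential ls'' + ?D * length ts + c Parse + c Result + 1"
      by fastforce
    have "parse_run E nullable c fs (t # ts) r (c Parse + (c Derive + n + m) + l)"
      using q some m(1) l(1) by (blast intro: parse_run.intros derive_run.intros)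
    moreover have "W * potential ls'' \<le> W * potential ls' + W * B"
      using mult_le_mono2[OF m(3), of W] by (simp add: add_mult_distrib2)
    with n m(2) l(2) have "c Parse + (c Derive + n + m) + l
        \<le> W * potential (snd fs) + (?D * length ts + ?D) + c Parse + c Result + 1" by linarith
    moreover have "?D * length (t # ts) = ?D * length ts + ?D" by simp
    ultimately show ?thesis by metis
  qed
qed

theorem mainTheorem2:
  fixes E :: "('v, 't, 'k, 'x) env"
    and c :: "routine \<Rightarrow> nat"
    and s :: "('v, 'k, 'x) stx"
    and T :: 't
  assumes "valid_env E"
    and "syntax_of E T s"
    and "LL1 E s"
  shows "\<exists>C::nat. \<forall>nullable ts.
    nullable_function E nullable \<longrightarrow> (\<forall>t\<in>set ts. is_token E t) \<longrightarrow>
    (\<exists>r n. parse_run E nullable c (focus s) ts r n \<and> n \<le> C * (length ts + 1))"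
proof -
  interpret valid_env E by fact
  obtain R where R: "finite R" "closed_stxs E R" "s \<in> R" "\<forall>u\<in>R. LL1 E u"
    using finite_closed_LL1[OF assms] by blast
  obtain B where B: "\<forall>u\<in>R. \<forall>k\<in>kinds E. k \<in> FIRST E u \<longrightarrow> pierce_bounded E c k u B"
    using finite_pierce_bounded[OF R(1) finite_kinds R(4), of c] by blast
  \<comment> \<open>Large enough for the weights required by both \<open>locate\<close> and
    \<open>result\<close>.\<close>
  define W where "W = 2 * c Plug + c Locate + c Result + 4"
  define D where "D = c Parse + c Derive + c Locate + 2 + B + W * B"
  have good: "good_focused R (focus s)"
    using R(3) by (simp add: good_focused_def focus_def)
  show ?thesis
  \<comment> \<open>The closing \<open>parse\<close> and \<open>result\<close> calls are charged to
    the extra unit in \<open>length ts + 1\<close>; \<open>D\<close> already contains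
    \<open>c Parse\<close>.\<close>
  proof (intro exI[of _ "D + c Result + 1"] allI impI)
    fix nullable ts
    assume nf: "nullable_function E nullable" and ts: "\<forall>t\<in>set ts. is_token E t"
    have "\<exists>r n. parse_run E nullable c (focus s) ts r n \<and>
      n \<le> W * potential (snd (focus s)) + D * length ts + c Parse + c Result + 1"
      unfolding D_def
    proof (rule parse_run_amortized[OF R(2) _ nf _ _ ts good])
      show "pierce_bounded E c (getKind E t) u B"
        if "u \<in> R" "is_token E t" "getKind E t \<in> FIRST E u" for u t
        using that B getKind_in_kinds by simp
    qed (simp_all add: W_def)
    \<comment> \<open>The initial context is empty, so its potential term vanishes.\<close>
    then obtain r n where "parse_run E nullable c (focus s) ts r n"
      and n: "n \<le> D * length ts + c Parse + c Result + 1"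
      by (auto simp: focus_def)
    moreover have "n \<le> (D + c Result + 1) * (length ts + 1)"
      using n by (simp add: algebra_simps D_def)
    ultimately show "\<exists>r n. parse_run E nullable c (focus s) ts r n \<and>
        n \<le> (D + c Result + 1) * (length ts + 1)" by blast
  qed
qed

end
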